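(* Assume the Gaussian limit-layer hypotheses stated in the context for the $N\times N$ trained limit layer $W_2^*(N)=S_2^*(N)+R_2^*(N)$ with $R_2^*(N)_{ij}$ iid $N(0,g_*(N)/N)$. Then the Gaussian variance scale satisfies $$g_*(N)\,N\to0\qquad(N\to\infty).$$ Consequently the Marchenko--Pastur singular-value edge of the limit perturbation satisfies $$\sigma_{+,*}^{\mathrm{bulk}}(N)=2\sqrt{g_*(N)}\to0.$$ For a rectangular $N\times M_N$ perturbation $R_N$ with iid entries $N(0,g_*(N)/N)$, the corresponding Frobenius collapse condition is $g_*(N)M_N\to0$ (that is, $\|R_N\|_F\to0$ in probability if and only if $g_*(N)M_N\to0$), and this is equivalent to $g_*(N)N\to0$ when $M_N/N\to c\in(0,\infty)$.
   Context: Setting. For each $N$ there is a classifier network $\phi(\cdot,\alpha)=\rho\circ X(\cdot,\alpha)$ with $K$ classes and weight matrices $W_i$; $\rho(v)_i=e^{v_i}/\sum_{j=1}^K e^{v_j}$, $X(s,\alpha)\in\mathbb R^K$ are the logits. $T$ is a finite nonempty training set, fixed independently of $N$, with correct classes $C(s)\in\{1,\dots,K\}$. For $\lambda_{\mathrm{reg}}>0$ the loss is $$L(\alpha)=-\frac1{|T|}\sum_{s\in T}\log\big(\phi_{C(s)}(s,\alpha)\big)+\lambda_{\mathrm{reg}}\sum_i\|W_i\|_F^2 .$$ Gaussian limit-layer hypotheses. (i) For each $N$ the random training path $\alpha(t,N)$ converges in probability as $t\to\infty$ to $\alpha^*(N)$, whose distinguished $N\times N$ layer matrix is $W_2^*(N)=S_2^*(N)+R_2^*(N)$.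 At $\alpha^*(N)$, $\phi=\rho\circ\psi_2\circ(R_2^*(N)+S_2^*(N))\circ\psi_1$, where $\psi_1$ (values in $\mathbb R^N$) and $\psi_2:\mathbb R^N\to\mathbb R^K$ may depend on $N$ and on the remaining parameters. (ii) Conditionally on $(S_2^*(N),\psi_1,\psi_2)$ the entries of $R_2^*(N)$ are iid $N(0,g_*(N)/N)$, with $g_*(N)\ge0$ deterministic. (iii) For each $s\in T$ there is a set $\mathcal U_s\supseteq\{(S_2^*(N)+\vartheta R_2^*(N))\psi_1(s):\vartheta\in[0,1]\}$ with $$L_{\psi_2}(s):=\sup_{v,w\in\mathcal U_s,\,v\ne w}\frac{\|\psi_2(v)-\psi_2(w)\|_\infty}{\|v-w\|_\infty}<\infty .$$ (iv) There are nonnegative $d_1(N),d_2(N)\to0$ and a nonnegative function $J(v)$ of $v$ only such that for every $v$ measurable with respect to $\sigma(S_2^*(N),\psi_1,\psi_2)$, $\mathbb P(\|R_2^*(N)v\|_\infty>d_1(N)J(v)\mid S_2^*(N),\psi_1,\psi_2)\le d_2(N)$. (v) With $a_\phi(N,s):=J(\psi_1(s))L_{\psi_2}(s)d_1(N)$, for all $s\in T$ one has $a_\phi(N,s)\to0$ as $N\to\infty$ (in probability if random). (vi) $\langle S_2^*(N),R_2^*(N)\rangle_F\to0$ in probability as $N\to\infty$. (vii) Let $\alpha^*_\vartheta(N)$ denote $\alpha^*(N)$ with $W_2^*(N)$ replaced by $S_2^*(N)+\vartheta R_2^*(N)$. There are nonnegative random variables $\epsilon_N\to0$ in probability such that the event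 $\liminf_{h\downarrow0}h^{-1}\big(L(\alpha^*_{1-h}(N))-L(\alpha^*(N))\big)\ge-\epsilon_N$ has probability tending to one. The Marchenko--Pastur singular-value edge of an $N\times M_N$ matrix with iid centered entries of variance $\sigma^2$ and aspect ratio $c=M_N/N$ is $\sigma_+=\sqrt{N\lambda_+}$ with $\lambda_+=\sigma^2(1+\sqrt c)^2$. $\|\cdot\|_F$, $\langle\cdot,\cdot\rangle_F$ are the Frobenius norm and inner product; $\|\cdot\|_\infty$ of a vector is the maximum norm. *)

theory Defs
  imports "HOL-Probability.Probability" "Jordan_Normal_Form.Matrix"
begin

unbundle no vec_syntax
hide_type (open) Finite_Cartesian_Product.vec
hide_const (open) Finite_Cartesian_Product.vec

section \<open>Norms on vectors and matrices of variable size\<close>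

text \<open>Inserting \<open>0\<close> only matters for vectors of dimension \<open>0\<close>.\<close>

definition max_norm :: "real vec \<Rightarrow> real" where
  "max_norm v = Max (insert 0 ((\<lambda>i. \<bar>v $ i\<bar>) ` {..<dim_vec v}))"

definition frob_inner :: "real mat \<Rightarrow> real mat \<Rightarrow> real" where
  "frob_inner A B = (\<Sum>i<dim_row A. \<Sum>j<dim_col A. A $$ (i,j) * B $$ (i,j))"

definition frob_norm :: "real mat \<Rightarrow> real" where
  "frob_norm A = sqrt (frob_inner A A)"

text \<open>The supremum is taken in \<^typ>\<open>ennreal\<close>: finiteness is the condition \<open>< \<infinity>\<close>, and
  the constant is \<open>0\<close> when \<open>U\<close> has at most one point.\<close>

definition max_lipschitz :: "real vec set \<Rightarrow> (real vec \<Rightarrow> real vec) \<Rightarrow> ennreal" where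
  "max_lipschitz U f =
     (SUP (v, w) \<in> {(v, w). v \<in> U \<and> w \<in> U \<and> v \<noteq> w}.
        ennreal (max_norm (f v - f w) / max_norm (v - w)))"


section \<open>Network parameters and loss\<close>

text \<open>A parameter \<open>\<alpha>\<close> consists of the weight matrices \<open>W i\<close> (\<open>i\<close> ranging over a finite layer set)
  and a vector collecting all parameters that are not regularised, such as biases.\<close>

type_synonym params = "(nat \<Rightarrow> real mat) \<times> real vec"

definition params_carrier ::
    "nat set \<Rightarrow> (nat \<Rightarrow> nat) \<Rightarrow> (nat \<Rightarrow> nat) \<Rightarrow> nat \<Rightarrow> params set" where
  "params_carrier I nr nc q =
     {(W, b). (\<forall>i\<in>I. W i \<in> carrier_mat (nr i) (nc i)) \<and> b \<in> carrier_vec q}"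

definition set_layer :: "nat \<Rightarrow> real mat \<Rightarrow> params \<Rightarrow> params" where
  "set_layer l A \<alpha> = ((fst \<alpha>)(l := A), snd \<alpha>)"

definition params_dist :: "nat set \<Rightarrow> params \<Rightarrow> params \<Rightarrow> real" where
  "params_dist I \<alpha> \<beta> =
     sqrt ((\<Sum>i\<in>I. (frob_norm (fst \<alpha> i - fst \<beta> i))\<^sup>2)
           + (\<Sum>j<dim_vec (snd \<alpha>). (snd \<alpha> $ j - snd \<beta> $ j)\<^sup>2))"

definition softmax :: "real vec \<Rightarrow> real vec" where
  "softmax v = vec (dim_vec v) (\<lambda>i. exp (v $ i) / (\<Sum>j<dim_vec v. exp (v $ j)))"

text \<open>\<open>X s \<alpha>\<close> are the logits; classes are numbered from \<open>0\<close>, so \<open>C s < K\<close>.\<close>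

definition loss ::
    "'s set \<Rightarrow> ('s \<Rightarrow> nat) \<Rightarrow> real \<Rightarrow> nat set \<Rightarrow> ('s \<Rightarrow> params \<Rightarrow> real vec) \<Rightarrow> params \<Rightarrow> real" where
  "loss T C lam I X \<alpha> =
     - (1 / real (card T)) * (\<Sum>s\<in>T. ln (softmax (X s \<alpha>) $ C s))
     + lam * (\<Sum>i\<in>I. (frob_norm (fst \<alpha> i))\<^sup>2)"


section \<open>Probability\<close>

definition random_vec :: "'a measure \<Rightarrow> nat \<Rightarrow> ('a \<Rightarrow> real vec) \<Rightarrow> bool" where
  "random_vec M n v \<longleftrightarrow>
     (\<forall>\<omega>\<in>space M. v \<omega> \<in> carrier_vec n) \<and> (\<forall>i<n. (\<lambda>\<omega>. v \<omega> $ i) \<in> borel_measurable M)"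

definition random_mat :: "'a measure \<Rightarrow> nat \<Rightarrow> nat \<Rightarrow> ('a \<Rightarrow> real mat) \<Rightarrow> bool" where
  "random_mat M m n A \<longleftrightarrow>
     (\<forall>\<omega>\<in>space M. A \<omega> \<in> carrier_mat m n) \<and>
     (\<forall>i<m. \<forall>j<n. (\<lambda>\<omega>. A \<omega> $$ (i,j)) \<in> borel_measurable M)"

definition random_params ::
    "'a measure \<Rightarrow> nat set \<Rightarrow> (nat \<Rightarrow> nat) \<Rightarrow> (nat \<Rightarrow> nat) \<Rightarrow> nat \<Rightarrow> ('a \<Rightarrow> params) \<Rightarrow> bool" where
  "random_params M I nr nc q \<alpha> \<longleftrightarrow>
     (\<forall>i\<in>I. random_mat M (nr i) (nc i) (\<lambda>\<omega>. fst (\<alpha> \<omega>) i)) \<and>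
     random_vec M q (\<lambda>\<omega>. snd (\<alpha> \<omega>))"

text \<open>Convergence to \<open>0\<close> in probability; the probability space may vary with the index.
  Measurability has to be required, since \<^const>\<open>measure\<close> is \<open>0\<close> on non-measurable sets.\<close>

definition tends_to_0_in_prob ::
    "('i \<Rightarrow> 'a measure) \<Rightarrow> ('i \<Rightarrow> 'a \<Rightarrow> real) \<Rightarrow> 'i filter \<Rightarrow> bool" where
  "tends_to_0_in_prob M Y F \<longleftrightarrow>
     (\<forall>\<^sub>F i in F. Y i \<in> borel_measurable (M i)) \<and>
     (\<forall>e>0. ((\<lambda>i. measure (M i) {\<omega> \<in> space (M i). \<bar>Y i \<omega>\<bar> > e}) \<longlongrightarrow> 0) F)"

text \<open>\<open>N(0,v)\<close> with variance \<open>v \<ge> 0\<close>, the point mass at \<open>0\<close> if \<open>v = 0\<close>.\<close>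

definition centered_gaussian :: "real \<Rightarrow> real measure" where
  "centered_gaussian v =
     (if v = 0 then return borel 0 else density lborel (\<lambda>x. ennreal (normal_density 0 (sqrt v) x)))"

definition iid_gaussian_entries ::
    "'a measure \<Rightarrow> nat \<Rightarrow> nat \<Rightarrow> real \<Rightarrow> ('a \<Rightarrow> real mat) \<Rightarrow> bool" where
  "iid_gaussian_entries M m n v R \<longleftrightarrow>
     prob_space.indep_vars M (\<lambda>_. borel) (\<lambda>(i, j) \<omega>. R \<omega> $$ (i,j)) ({..<m} \<times> {..<n}) \<and>
     (\<forall>i<m. \<forall>j<n. distr M borel (\<lambda>\<omega>. R \<omega> $$ (i,j)) = centered_gaussian v)"

text \<open>Only meaningful for \<open>A \<in> sets M\<close>; otherwise \<^const>\<open>real_cond_exp\<close> is \<open>0\<close>.\<close>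

definition cond_prob_given :: "'a measure \<Rightarrow> 'a measure \<Rightarrow> 'a set \<Rightarrow> 'a \<Rightarrow> real" where
  "cond_prob_given M F A = real_cond_exp M F (indicat_real A)"

text \<open>Conditional joint law on measurable rectangles: given \<open>F\<close>, the entries are independent, each
  with law \<open>N(0,v)\<close>.\<close>

definition cond_iid_gaussian_entries ::
    "'a measure \<Rightarrow> 'a measure \<Rightarrow> nat \<Rightarrow> nat \<Rightarrow> real \<Rightarrow> ('a \<Rightarrow> real mat) \<Rightarrow> bool" where
  "cond_iid_gaussian_entries M F m n v R \<longleftrightarrow>
     (\<forall>B. (\<forall>i<m. \<forall>j<n. B i j \<in> sets borel) \<longrightarrow>
        (AE \<omega> in M.
           cond_prob_given M F {\<omega> \<in> space M. \<forall>i<m. \<forall>j<n. R \<omega> $$ (i,j) \<in> B i j} \<omega>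
           = (\<Prod>i<m. \<Prod>j<n. measure (centered_gaussian v) (B i j))))"

definition generated_sigma :: "'a measure \<Rightarrow> ('a \<Rightarrow> real) set \<Rightarrow> 'a measure" where
  "generated_sigma M G = sigma (space M) {Y -` B \<inter> space M | Y B. Y \<in> G \<and> B \<in> sets borel}"

text \<open>\<open>\<sigma>(S, \<psi>1, \<psi>2)\<close>, where a random function generates the \<open>\<sigma>\<close>-algebra of all its evaluations.\<close>

definition layer_sigma ::
    "'a measure \<Rightarrow> nat \<Rightarrow> nat \<Rightarrow> ('a \<Rightarrow> real mat) \<Rightarrow> ('a \<Rightarrow> 's \<Rightarrow> real vec)
       \<Rightarrow> ('a \<Rightarrow> real vec \<Rightarrow> real vec) \<Rightarrow> 'a measure" where
  "layer_sigma M n K S \<psi>1 \<psi>2 = generated_sigma M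
     ({\<lambda>\<omega>. S \<omega> $$ (i,j) | i j. i < n \<and> j < n}
      \<union> {\<lambda>\<omega>. \<psi>1 \<omega> s $ i | s i. i < n}
      \<union> {\<lambda>\<omega>. \<psi>2 \<omega> v $ k | v k. v \<in> carrier_vec n \<and> k < K})"


section \<open>Marchenko--Pastur edge\<close>

definition mp_lambda_plus :: "real \<Rightarrow> real \<Rightarrow> real" where
  "mp_lambda_plus var c = var * (1 + sqrt c)\<^sup>2"

definition mp_singular_edge :: "nat \<Rightarrow> nat \<Rightarrow> real \<Rightarrow> real" where
  "mp_singular_edge n m var = sqrt (real n * mp_lambda_plus var (real m / real n))"

end

theory Submission
  imports Defs
begin

text \<open>Shrinking the perturbation from \<open>S + R\<close> to \<open>S + (1 - h) R\<close> changes each log-probability by at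
  most \<open>2 h a\<close>, with \<open>a\<close> the perturbation bound of hypothesis (v), and changes the regulariser by
  \<open>- lam (2 h \<langle>S, R\<rangle> + (2 h - h\<^sup>2) \<parallel>R\<parallel>\<^sup>2)\<close>. Near-stationarity of the loss therefore gives
  \<open>2 lam \<parallel>R\<parallel>\<^sup>2 \<le> \<epsilon> + 2 a - 2 lam \<langle>S, R\<rangle>\<close> with probability tending to one, where \<open>2 a\<close> stands for its
  average over the training set, so \<open>\<parallel>R\<parallel>\<close> tends to \<open>0\<close> in probability. A nonnegative \<open>Y\<close> tends to \<open>0\<close>
  in probability iff its Laplace transform \<open>E (exp (- Y))\<close> tends to \<open>1\<close>; for a matrix of \<open>n\<close> independent
  centred Gaussian entries of variance \<open>v\<close> and \<open>Y = \<parallel>R\<parallel>\<^sup>2\<close> it equals \<open>(1 + 2 v) powr (- n / 2)\<close>, and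
  it tends to \<open>1\<close> iff \<open>n v\<close> tends to \<open>0\<close>.\<close>

section \<open>Laplace transforms and convergence in probability\<close>

lemma prob_space_centered_gaussian:
  assumes "v \<ge> 0"
  shows "prob_space (centered_gaussian v)"
  using assms by (auto simp: centered_gaussian_def intro!: prob_space_return prob_space_normal_density)

lemma sets_centered_gaussian [simp, measurable_cong]: "sets (centered_gaussian v) = sets borel"
  by (simp add: centered_gaussian_def)

lemma space_centered_gaussian [simp]: "space (centered_gaussian v) = UNIV"
  by (simp add: centered_gaussian_def)

text \<open>Multiplying a centred Gaussian density by \<open>exp (- x\<^sup>2)\<close> gives a
  narrower centred Gaussian density times a constant, and that constant is the integral. The point
  mass at \<open>v = 0\<close> is covered separately.\<close>

lemma integral_exp_square_centered_gaussian:
  assumes "v \<ge> 0"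
  shows "(\<integral>x. exp (- x\<^sup>2) \<partial>centered_gaussian v) = 1 / sqrt (1 + 2 * v)"
proof (cases "v = 0")
  case True
  then show ?thesis by (simp add: centered_gaussian_def integral_return)
next
  case False
  define s where "s = sqrt v"
  have s: "s > 0" "v = s\<^sup>2" using False assms by (auto simp: s_def)
  \<comment> \<open>The narrower standard deviation comes from matching exponents:
    \<open>1 / (2 * t\<^sup>2) = 1 / (2 * s\<^sup>2) + 1\<close>.\<close>
  define t where "t = s / sqrt (1 + 2 * s\<^sup>2)"
  have pos: "1 + 2 * s\<^sup>2 > 0" by (intro add_pos_nonneg) auto
  have t: "t > 0" "t\<^sup>2 = s\<^sup>2 / (1 + 2 * s\<^sup>2)"
    using s pos by (auto simp: t_def power_divide)
  have eq: "normal_density 0 s x * exp (- x\<^sup>2) = 1 / sqrt (1 + 2 * s\<^sup>2) * normal_density 0 t x" for x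
  proof -
    have e: "- x\<^sup>2 / (2 * s\<^sup>2) + - x\<^sup>2 = - x\<^sup>2 / (2 * t\<^sup>2)"
      using s pos by (simp add: t(2) field_simps)
    have c: "1 / sqrt (2 * pi * s\<^sup>2) = 1 / sqrt (1 + 2 * s\<^sup>2) * (1 / sqrt (2 * pi * t\<^sup>2))"
      using s pos by (simp add: t(2) real_sqrt_mult real_sqrt_divide field_simps)
    show ?thesis
      unfolding normal_density_def c diff_0_right
      by (simp only: mult.assoc exp_add[symmetric] e)
  qed
  have "(\<integral>x. exp (- x\<^sup>2) \<partial>centered_gaussian v) = (\<integral>x. normal_density 0 s x * exp (- x\<^sup>2) \<partial>lborel)"
    using False s by (subst centered_gaussian_def) (simp add: s_def[symmetric] integral_density)
  also have "\<dots> = 1 / sqrt (1 + 2 * s\<^sup>2)"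
    unfolding eq using t(1) by simp
  finally show ?thesis by (simp add: s)
qed

text \<open>With \<open>A\<close> the event that \<open>Y\<close> exceeds \<open>e\<close>,
  \<open>exp (- Y)\<close> lies pointwise between \<open>exp (- e)\<close> times the indicator of
  the complement of \<open>A\<close> and \<open>1 - (1 - exp (- e))\<close> times the indicator of
  \<open>A\<close>. Integrating bounds the transform by the tail and conversely. The gain is that
  the transform factorises over independent entries, whereas tails do not.\<close>

lemma tends_to_0_in_prob_iff_expectation_exp:
  assumes prob: "\<forall>\<^sub>F i in F. prob_space (M i)"
    and meas: "\<forall>\<^sub>F i in F. Y i \<in> borel_measurable (M i)"
    and nonneg: "\<And>i \<omega>. Y i \<omega> \<ge> 0"
  shows "tends_to_0_in_prob M Y F \<longleftrightarrow> ((\<lambda>i. \<integral>\<omega>. exp (- Y i \<omega>) \<partial>M i) \<longlongrightarrow> 1) F"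
proof
  let ?E = "\<lambda>i. \<integral>\<omega>. exp (- Y i \<omega>) \<partial>M i"
  let ?P = "\<lambda>i e. measure (M i) {\<omega> \<in> space (M i). \<bar>Y i \<omega>\<bar> > e}"
  have lower: "exp (- e) * (1 - ?P i e) \<le> ?E i"
    and upper: "?E i \<le> 1"
    and tail: "?P i e * (1 - exp (- e)) \<le> 1 - ?E i"
    if "prob_space (M i)" "Y i \<in> borel_measurable (M i)" "e > 0" for i e
  proof -
    interpret prob_space "M i" by fact
    have m[measurable]: "Y i \<in> borel_measurable (M i)" by fact
    have int: "integrable (M i) (\<lambda>\<omega>. exp (- Y i \<omega>))"
      by (rule integrable_const_bound[where B = 1]) (auto simp: nonneg)
    define A where "A = {\<omega> \<in> space (M i). \<bar>Y i \<omega>\<bar> > e}"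
    have A[measurable]: "A \<in> sets (M i)" unfolding A_def by measurable
    have eI: "integrable (M i) (indicat_real A)"
      by (intro integrable_real_indicator) (auto simp: emeasure_eq_measure)
    then have eI': "integrable (M i) (\<lambda>\<omega>. (1 - exp (- e)) * indicat_real A \<omega>)"
      by (intro integrable_mult_right)
    have "exp (- e) * (1 - prob A) = (\<integral>\<omega>. exp (- e) * (1 - indicat_real A \<omega>) \<partial>M i)"
      using Bochner_Integration.integral_diff[OF integrable_const[of 1] eI] by (simp add: prob_space)
    also have "\<dots> \<le> ?E i"
      by (intro integral_mono int integrable_mult_right Bochner_Integration.integrable_diff
          integrable_const eI) (auto simp: A_def indicator_def nonneg)
    finally show "exp (- e) * (1 - ?P i e) \<le> ?E i" by (simp add: A_def)
    have "?E i \<le> (\<integral>\<omega>. 1 - (1 - exp (- e)) * indicat_real A \<omega> \<partial>M i)"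
      by (intro integral_mono int integrable_mult_right Bochner_Integration.integrable_diff
          integrable_const eI) (auto simp: A_def indicator_def nonneg)
    also have "\<dots> = 1 - (1 - exp (- e)) * prob A"
      using Bochner_Integration.integral_diff[OF integrable_const[of 1] eI'] by (simp add: prob_space)
    finally have up: "?E i \<le> 1 - (1 - exp (- e)) * prob A" .
    then show "?P i e * (1 - exp (- e)) \<le> 1 - ?E i" by (simp add: A_def mult.commute)
    have "(1 - exp (- e)) * prob A \<ge> 0" using that by simp
    then show "?E i \<le> 1" using up by linarith
  qed
  note ev = eventually_conj[OF prob meas]
  {
    assume Y: "tends_to_0_in_prob M Y F"
    show "(?E \<longlongrightarrow> 1) F"
    proof (rule order_tendstoI)
      fix a :: real assume "a < 1"
      \<comment> \<open>With this \<open>e\<close>,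
        \<open>exp (- e) \<ge> 1 - e = (1 + a) / 2 > a\<close>, so the lower bound eventually
        exceeds \<open>a\<close>.\<close>
      define e where "e = (1 - a) / 2"
      have e: "e > 0" "exp (- e) > a"
        using \<open>a < 1\<close> exp_ge_add_one_self[of "- e"] by (auto simp: e_def field_simps)
      have "((\<lambda>i. exp (- e) * (1 - ?P i e)) \<longlongrightarrow> exp (- e) * (1 - 0)) F"
        using Y e(1) unfolding tends_to_0_in_prob_def by (intro tendsto_intros) auto
      then have "\<forall>\<^sub>F i in F. exp (- e) * (1 - ?P i e) > a"
        using e by (intro order_tendstoD) auto
      then show "\<forall>\<^sub>F i in F. a < ?E i"
        using ev
      proof eventually_elim
        case (elim i)
        note elim(1)
        also have "exp (- e) * (1 - ?P i e) \<le> ?E i"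
          by (rule lower) (use elim e in auto)
        finally show ?case .
      qed
    next
      fix a :: real assume "1 < a"
      show "\<forall>\<^sub>F i in F. ?E i < a"
        using ev
      proof eventually_elim
        case (elim i)
        have "?E i \<le> 1" by (rule upper[of i 1]) (use elim in auto)
        also note \<open>1 < a\<close>
        finally show ?case .
      qed
    qed
  next
    assume E: "(?E \<longlongrightarrow> 1) F"
    have "((\<lambda>i. ?P i e) \<longlongrightarrow> 0) F" if "e > 0" for e
    proof (rule tendsto_sandwich[OF _ _ tendsto_const])
      show "\<forall>\<^sub>F i in F. ?P i e \<le> (1 - ?E i) / (1 - exp (- e))"
        using ev
      proof eventually_elim
        case (elim i)
        have "?P i e * (1 - exp (- e)) \<le> 1 - ?E i"
          by (rule tail) (use elim that in auto)
        then show ?case using that by (simp add: pos_le_divide_eq)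
      qed
      have "((\<lambda>i. (1 - ?E i) / (1 - exp (- e))) \<longlongrightarrow> (1 - 1) / (1 - exp (- e))) F"
        using that by (intro tendsto_intros E) auto
      then show "((\<lambda>i. (1 - ?E i) / (1 - exp (- e))) \<longlongrightarrow> 0) F" by simp
    qed simp
    with meas show "tends_to_0_in_prob M Y F" by (simp add: tends_to_0_in_prob_def)
  }
qed

text \<open>A tail event of \<open>Y\<close> is covered, up to a null set, by the tail event of
  \<open>Z\<close> and the complement of \<open>A\<close>, whose probability vanishes. Hence a
  pathwise bound valid only on events of probability tending to one suffices.\<close>

lemma tends_to_0_in_prob_dominated:
  assumes prob: "\<forall>\<^sub>F i in F. prob_space (M i)"
    and meas: "\<forall>\<^sub>F i in F. Y i \<in> borel_measurable (M i)"
    and Z: "tends_to_0_in_prob M Z F"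
    and A: "\<forall>\<^sub>F i in F. A i \<in> sets (M i)" "((\<lambda>i. measure (M i) (A i)) \<longlongrightarrow> 1) F"
    and dom: "\<forall>\<^sub>F i in F. AE \<omega> in M i. \<omega> \<in> A i \<longrightarrow> \<bar>Y i \<omega>\<bar> \<le> \<bar>Z i \<omega>\<bar>"
  shows "tends_to_0_in_prob M Y F"
  unfolding tends_to_0_in_prob_def
proof (intro conjI meas allI impI)
  fix e :: real assume "e > 0"
  let ?P = "\<lambda>Y i. measure (M i) {\<omega> \<in> space (M i). \<bar>Y i \<omega>\<bar> > e}"
  have measZ: "\<forall>\<^sub>F i in F. Z i \<in> borel_measurable (M i)"
    and Z0: "((\<lambda>i. ?P Z i) \<longlongrightarrow> 0) F"
    using Z \<open>e > 0\<close> by (auto simp: tends_to_0_in_prob_def)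
  show "((\<lambda>i. ?P Y i) \<longlongrightarrow> 0) F"
  proof (rule tendsto_sandwich[OF _ _ tendsto_const])
    show "\<forall>\<^sub>F i in F. ?P Y i \<le> ?P Z i + (1 - measure (M i) (A i))"
      using prob meas measZ A(1) dom
    proof eventually_elim
      case (elim i)
      interpret prob_space "M i" by fact
      note [measurable] = elim(2-4)
      have "?P Y i \<le> prob ({\<omega> \<in> space (M i). \<bar>Z i \<omega>\<bar> > e} \<union> (space (M i) - A i))"
        using elim(5) by (intro finite_measure_mono_AE) auto
      also have "\<dots> \<le> ?P Z i + prob (space (M i) - A i)"
        by (intro measure_subadditive) auto
      finally show ?case by (simp add: prob_compl elim)
    qed
    have "((\<lambda>i. ?P Z i + (1 - measure (M i) (A i))) \<longlongrightarrow> 0 + (1 - 1)) F"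
      by (intro tendsto_intros Z0 A(2))
    then show "((\<lambda>i. ?P Z i + (1 - measure (M i) (A i))) \<longlongrightarrow> 0) F" by simp
  qed simp
qed

lemma tends_to_0_in_prob_add:
  assumes prob: "\<forall>\<^sub>F i in F. prob_space (M i)"
    and Y: "tends_to_0_in_prob M Y F" and Z: "tends_to_0_in_prob M Z F"
  shows "tends_to_0_in_prob M (\<lambda>i \<omega>. Y i \<omega> + Z i \<omega>) F"
proof -
  have meas: "\<forall>\<^sub>F i in F. Y i \<in> borel_measurable (M i)" "\<forall>\<^sub>F i in F. Z i \<in> borel_measurable (M i)"
    using Y Z by (auto simp: tends_to_0_in_prob_def)
  show ?thesis
    unfolding tends_to_0_in_prob_def
  proof (intro conjI allI impI)
    show "\<forall>\<^sub>F i in F. (\<lambda>\<omega>. Y i \<omega> + Z i \<omega>) \<in> borel_measurable (M i)"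
      using meas by eventually_elim simp
    fix e :: real assume "e > 0"
    let ?P = "\<lambda>Y i e. measure (M i) {\<omega> \<in> space (M i). \<bar>Y i \<omega>\<bar> > e}"
    show "((\<lambda>i. ?P (\<lambda>i \<omega>. Y i \<omega> + Z i \<omega>) i e) \<longlongrightarrow> 0) F"
    proof (rule tendsto_sandwich[OF _ _ tendsto_const])
      show "\<forall>\<^sub>F i in F. ?P (\<lambda>i \<omega>. Y i \<omega> + Z i \<omega>) i e \<le> ?P Y i (e / 2) + ?P Z i (e / 2)"
        using prob meas
      proof eventually_elim
        case (elim i)
        interpret prob_space "M i" by fact
        note [measurable] = elim(2-3)
        have "?P (\<lambda>i \<omega>. Y i \<omega> + Z i \<omega>) i e
            \<le> prob ({\<omega> \<in> space (M i). \<bar>Y i \<omega>\<bar> > e / 2} \<union> {\<omega> \<in> space (M i). \<bar>Z i \<omega>\<bar> > e / 2})"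
          by (intro finite_measure_mono) auto
        also have "\<dots> \<le> ?P Y i (e / 2) + ?P Z i (e / 2)"
          by (intro measure_subadditive) auto
        finally show ?case .
      qed
      have "((\<lambda>i. ?P Y i (e / 2) + ?P Z i (e / 2)) \<longlongrightarrow> 0 + 0) F"
        using Y Z half_gt_zero[OF \<open>e > 0\<close>] unfolding tends_to_0_in_prob_def
        by (intro tendsto_intros) blast+
      then show "((\<lambda>i. ?P Y i (e / 2) + ?P Z i (e / 2)) \<longlongrightarrow> 0) F" by simp
    qed simp
  qed
qed

lemma tends_to_0_in_prob_zero: "tends_to_0_in_prob M (\<lambda>i \<omega>. 0) F"
  by (simp add: tends_to_0_in_prob_def)

lemma tends_to_0_in_prob_cmult:
  assumes "tends_to_0_in_prob M Y F"
  shows "tends_to_0_in_prob M (\<lambda>i \<omega>. c * Y i \<omega>) F"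
proof (cases "c = 0")
  case True
  then show ?thesis by (simp add: tends_to_0_in_prob_zero)
next
  case False
  have "\<bar>c * y\<bar> > e \<longleftrightarrow> \<bar>y\<bar> > e / \<bar>c\<bar>" for y e
    using False by (simp add: abs_mult pos_divide_less_eq mult.commute)
  moreover have "\<forall>\<^sub>F i in F. (\<lambda>\<omega>. c * Y i \<omega>) \<in> borel_measurable (M i)"
    using assms unfolding tends_to_0_in_prob_def by (auto elim: eventually_mono)
  ultimately show ?thesis
    using assms False by (simp add: tends_to_0_in_prob_def)
qed

lemma tends_to_0_in_prob_sum:
  assumes "\<forall>\<^sub>F i in F. prob_space (M i)"
    and "finite T" "\<And>s. s \<in> T \<Longrightarrow> tends_to_0_in_prob M (\<lambda>i \<omega>. Y i \<omega> s) F"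
  shows "tends_to_0_in_prob M (\<lambda>i \<omega>. \<Sum>s\<in>T. Y i \<omega> s) F"
  using assms(2,3)
  by (induction T rule: finite_induct)
    (auto intro!: tends_to_0_in_prob_zero tends_to_0_in_prob_add assms(1))

text \<open>The thresholds \<open>e\<close> for \<open>Y\<close> and \<open>e\<^sup>2\<close> for
  its square describe the same event. This links the Frobenius norm to its square, for which the
  Laplace transform is explicit.\<close>

lemma tends_to_0_in_prob_square_iff:
  assumes "\<forall>\<^sub>F i in F. Y i \<in> borel_measurable (M i)"
  shows "tends_to_0_in_prob M (\<lambda>i \<omega>. (Y i \<omega>)\<^sup>2) F \<longleftrightarrow> tends_to_0_in_prob M Y F"
proof -
  have sq: "\<bar>y\<^sup>2\<bar> > e\<^sup>2 \<longleftrightarrow> \<bar>y\<bar> > e" if "e > 0" for e y :: real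
    using that abs_le_square_iff[of y e] by (simp flip: not_le)
  have "\<forall>\<^sub>F i in F. (\<lambda>\<omega>. (Y i \<omega>)\<^sup>2) \<in> borel_measurable (M i)"
    using assms by eventually_elim simp
  moreover have "(\<forall>e>0. ((\<lambda>i. measure (M i) {\<omega> \<in> space (M i). \<bar>(Y i \<omega>)\<^sup>2\<bar> > e}) \<longlongrightarrow> 0) F)
      \<longleftrightarrow> (\<forall>e>0. ((\<lambda>i. measure (M i) {\<omega> \<in> space (M i). \<bar>Y i \<omega>\<bar> > e}) \<longlongrightarrow> 0) F)"
    (is "?L \<longleftrightarrow> ?R")
  proof (intro iffI allI impI)
    fix e :: real assume "?L" "e > 0"
    then show "((\<lambda>i. measure (M i) {\<omega> \<in> space (M i). \<bar>Y i \<omega>\<bar> > e}) \<longlongrightarrow> 0) F"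
      using sq[of e] by (auto dest!: spec[of _ "e\<^sup>2"])
  next
    fix e :: real assume "?R" "e > 0"
    then show "((\<lambda>i. measure (M i) {\<omega> \<in> space (M i). \<bar>(Y i \<omega>)\<^sup>2\<bar> > e}) \<longlongrightarrow> 0) F"
      using sq[of "sqrt e"] by (auto dest!: spec[of _ "sqrt e"])
  qed
  ultimately show ?thesis using assms by (simp add: tends_to_0_in_prob_def)
qed

section \<open>Gaussian matrices\<close>

lemma frob_norm_square: "(frob_norm A)\<^sup>2 = frob_inner A A"
  by (simp add: frob_norm_def frob_inner_def sum_nonneg)

lemma frob_inner_self_nonneg: "frob_inner A A \<ge> 0"
  by (simp add: frob_inner_def sum_nonneg)

lemma frob_inner_carrier:
  "A \<in> carrier_mat m n \<Longrightarrow> frob_inner A B = (\<Sum>i<m. \<Sum>j<n. A $$ (i,j) * B $$ (i,j))"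
  by (auto simp: frob_inner_def)

lemma frob_inner_measurable:
  assumes "random_mat M m n A" "random_mat M m n B"
  shows "(\<lambda>\<omega>. frob_inner (A \<omega>) (B \<omega>)) \<in> borel_measurable M"
proof -
  have "(\<lambda>\<omega>. \<Sum>i<m. \<Sum>j<n. A \<omega> $$ (i,j) * B \<omega> $$ (i,j)) \<in> borel_measurable M"
    using assms by (intro borel_measurable_sum borel_measurable_times) (auto simp: random_mat_def)
  then show ?thesis
    using assms by (subst measurable_cong[OF frob_inner_carrier]) (auto simp: random_mat_def)
qed

lemma frob_norm_measurable:
  assumes "random_mat M m n A"
  shows "(\<lambda>\<omega>. frob_norm (A \<omega>)) \<in> borel_measurable M"
  unfolding frob_norm_def using frob_inner_measurable[OF assms assms] by simp

text \<open>The exponential turns the sum of squared entries into a product, and independence turns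
  its expectation into a product of one-dimensional transforms.\<close>

lemma (in prob_space) expectation_exp_frob_inner_gaussian:
  assumes R: "random_mat M m n R" and iid: "iid_gaussian_entries M m n v R" and v: "v \<ge> 0"
  shows "expectation (\<lambda>\<omega>. exp (- frob_inner (R \<omega>) (R \<omega>))) = (1 / sqrt (1 + 2 * v)) ^ (m * n)"
proof -
  let ?I = "{..<m} \<times> {..<n}"
  let ?X = "\<lambda>(i, j) \<omega>. exp (- (R \<omega> $$ (i,j))\<^sup>2)"
  have ind: "indep_vars (\<lambda>_. borel) (\<lambda>(i, j) \<omega>. R \<omega> $$ (i,j)) ?I"
    and law: "\<And>i j. i < m \<Longrightarrow> j < n \<Longrightarrow> distr M borel (\<lambda>\<omega>. R \<omega> $$ (i,j)) = centered_gaussian v"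
    using iid by (auto simp: iid_gaussian_entries_def)
  have meas: "(\<lambda>\<omega>. R \<omega> $$ (i,j)) \<in> borel_measurable M" if "i < m" "j < n" for i j
    using R that by (auto simp: random_mat_def)
  have meas': "(\<lambda>\<omega>. exp (- (R \<omega> $$ (i,j))\<^sup>2)) \<in> borel_measurable M"
    if "i < m" "j < n" for i j
    by (rule measurable_compose[OF meas[OF that], of "\<lambda>x. exp (- x\<^sup>2)"]) measurable
  have "indep_vars (\<lambda>_. borel) (\<lambda>ij \<omega>. exp (- (((\<lambda>(i, j) \<omega>. R \<omega> $$ (i,j)) ij \<omega>)\<^sup>2))) ?I"
    by (rule indep_vars_compose2[OF ind]) measurable
  then have ind': "indep_vars (\<lambda>_. borel) ?X ?I"
    by (simp add: case_prod_unfold)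
  have "expectation (\<lambda>\<omega>. exp (- frob_inner (R \<omega>) (R \<omega>))) = expectation (\<lambda>\<omega>. \<Prod>ij\<in>?I. ?X ij \<omega>)"
  proof (rule Bochner_Integration.integral_cong[OF refl])
    fix \<omega> assume "\<omega> \<in> space M"
    then have "frob_inner (R \<omega>) (R \<omega>) = (\<Sum>(i, j)\<in>?I. (R \<omega> $$ (i,j))\<^sup>2)"
      using R by (subst frob_inner_carrier[of _ m n])
        (auto simp: random_mat_def sum.cartesian_product power2_eq_square)
    then show "exp (- frob_inner (R \<omega>) (R \<omega>)) = (\<Prod>ij\<in>?I. ?X ij \<omega>)"
      by (simp add: exp_sum case_prod_unfold flip: sum_negf)
  qed
  also have "\<dots> = (\<Prod>ij\<in>?I. expectation (?X ij))"
    by (rule indep_vars_lebesgue_integral[OF _ ind'])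
      (auto intro!: integrable_const_bound[where B = 1] meas')
  also have "\<dots> = (\<Prod>ij\<in>?I. 1 / sqrt (1 + 2 * v))"
  proof (rule prod.cong[OF refl])
    fix ij assume "ij \<in> ?I"
    then obtain i j where ij: "ij = (i, j)" "i \<in> {..<m}" "j \<in> {..<n}" by blast
    have "expectation (\<lambda>\<omega>. exp (- (R \<omega> $$ (i,j))\<^sup>2))
        = (\<integral>x. exp (- x\<^sup>2) \<partial>distr M borel (\<lambda>\<omega>. R \<omega> $$ (i,j)))"
      using ij by (subst integral_distr) (auto intro!: meas)
    also have "\<dots> = 1 / sqrt (1 + 2 * v)"
      using ij v by (simp add: law integral_exp_square_centered_gaussian)
    finally show "expectation (?X ij) = 1 / sqrt (1 + 2 * v)"
      by (simp add: ij(1))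
  qed
  finally show ?thesis by (simp add: card_cartesian_product)
qed

text \<open>Both directions follow from
  \<open>exp (- n * v) \<le> (1 + 2 * v) powr (- n / 2) \<le> (1 + 2 * n * v) powr (- 1 / 2)\<close>.\<close>

lemma tendsto_gaussian_laplace_iff:
  fixes v :: "nat \<Rightarrow> real" and n :: "nat \<Rightarrow> nat"
  assumes v: "\<forall>\<^sub>F i in sequentially. v i \<ge> 0"
  shows "(\<lambda>i. (1 / sqrt (1 + 2 * v i)) ^ n i) \<longlonglongrightarrow> 1 \<longleftrightarrow> (\<lambda>i. n i * v i) \<longlonglongrightarrow> 0"
proof
  let ?L = "\<lambda>i. (1 / sqrt (1 + 2 * v i)) ^ n i"
  \<comment> \<open>Squaring removes the root and leaves a natural power of
    \<open>1 + 2 * v i\<close>, to which Bernoulli's inequality applies.\<close>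
  have sq: "(?L i)\<^sup>2 = 1 / (1 + 2 * v i) ^ n i" if "v i \<ge> 0" for i
    using that by (simp add: power_divide power_mult[symmetric] mult.commute[of _ 2] power_mult)
  have pos: "?L i > 0" if "v i \<ge> 0" for i using that by simp
  have bernoulli: "1 + 2 * (n i * v i) \<le> (1 + 2 * v i) ^ n i" if "v i \<ge> 0" for i
    using Bernoulli_inequality[of "2 * v i" "n i"] that by (simp add: mult.left_commute)
  {
    assume L: "?L \<longlonglongrightarrow> 1"
    show "(\<lambda>i. n i * v i) \<longlonglongrightarrow> 0"
    proof (rule tendsto_sandwich[OF _ _ tendsto_const])
      show "\<forall>\<^sub>F i in sequentially. 0 \<le> n i * v i"
        using v by eventually_elim simp
      show "\<forall>\<^sub>F i in sequentially. n i * v i \<le> (1 / (?L i)\<^sup>2 - 1) / 2"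
        using v by eventually_elim (use bernoulli in \<open>force simp: sq\<close>)
      have "(\<lambda>i. (1 / (?L i)\<^sup>2 - 1) / 2) \<longlonglongrightarrow> (1 / 1\<^sup>2 - 1) / 2"
        by (intro tendsto_intros L) auto
      then show "(\<lambda>i. (1 / (?L i)\<^sup>2 - 1) / 2) \<longlonglongrightarrow> 0" by simp
    qed
  next
    assume nv: "(\<lambda>i. n i * v i) \<longlonglongrightarrow> 0"
    show "?L \<longlonglongrightarrow> 1"
    proof (rule tendsto_sandwich[OF _ _ _ tendsto_const])
      show "\<forall>\<^sub>F i in sequentially. ?L i \<le> 1"
        using v by eventually_elim (intro power_le_one, auto)
      show "\<forall>\<^sub>F i in sequentially. exp (- (n i * v i)) \<le> ?L i"
        using v
      proof eventually_elim
        case (elim i)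
        have "sqrt (1 + 2 * v i) \<le> sqrt (exp (2 * v i))"
          using exp_ge_add_one_self[of "2 * v i"] by simp
        also have "sqrt (exp (2 * v i)) = exp (v i)"
          by (rule real_sqrt_unique) (auto simp: power2_eq_square simp flip: exp_add)
        finally have "exp (- v i) \<le> 1 / sqrt (1 + 2 * v i)"
          using elim by (simp add: exp_minus field_simps)
        then have "exp (- v i) ^ n i \<le> ?L i" by (intro power_mono) auto
        then show ?case by (simp flip: exp_of_nat_mult)
      qed
      have "(\<lambda>i. exp (- (n i * v i))) \<longlonglongrightarrow> exp (- 0)"
        by (intro tendsto_intros nv)
      then show "(\<lambda>i. exp (- (n i * v i))) \<longlonglongrightarrow> 1" by simp
    qed
  }
qed

text \<open>There are \<open>N * m N\<close> entries of variance \<open>\<gamma> N / N\<close>, so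
  the total variance is \<open>\<gamma> N * m N\<close>. The lemma serves twice: for the square
  trained layer and for the rectangular claim.\<close>

lemma tends_to_0_in_prob_frob_norm_gaussian_iff:
  fixes Q :: "nat \<Rightarrow> 'b measure" and m :: "nat \<Rightarrow> nat" and R :: "nat \<Rightarrow> 'b \<Rightarrow> real mat"
    and \<gamma> :: "nat \<Rightarrow> real"
  assumes ass: "\<And>N. N \<ge> 1 \<Longrightarrow> prob_space (Q N) \<and> \<gamma> N \<ge> 0 \<and> random_mat (Q N) N (m N) (R N)
                  \<and> iid_gaussian_entries (Q N) N (m N) (\<gamma> N / real N) (R N)"
  shows "tends_to_0_in_prob Q (\<lambda>N \<omega>. frob_norm (R N \<omega>)) sequentially
         \<longleftrightarrow> (\<lambda>N. \<gamma> N * real (m N)) \<longlonglongrightarrow> 0"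
proof -
  note ge1 = eventually_ge_at_top[of "1::nat"]
  have "\<forall>\<^sub>F N in sequentially. (\<lambda>\<omega>. frob_norm (R N \<omega>)) \<in> borel_measurable (Q N)"
    using ge1 by eventually_elim (use ass frob_norm_measurable in blast)
  then have "tends_to_0_in_prob Q (\<lambda>N \<omega>. frob_norm (R N \<omega>)) sequentially
      \<longleftrightarrow> tends_to_0_in_prob Q (\<lambda>N \<omega>. frob_inner (R N \<omega>) (R N \<omega>)) sequentially"
    by (subst tends_to_0_in_prob_square_iff[symmetric]) (auto simp: frob_norm_square)
  also have "\<dots> \<longleftrightarrow> (\<lambda>N. \<integral>\<omega>. exp (- frob_inner (R N \<omega>) (R N \<omega>)) \<partial>Q N) \<longlonglongrightarrow> 1"
  proof (rule tends_to_0_in_prob_iff_expectation_exp)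
    show "\<forall>\<^sub>F N in sequentially. prob_space (Q N)"
      using ge1 by eventually_elim (use ass in blast)
    show "\<forall>\<^sub>F N in sequentially. (\<lambda>\<omega>. frob_inner (R N \<omega>) (R N \<omega>)) \<in> borel_measurable (Q N)"
      using ge1 by eventually_elim (use ass frob_inner_measurable in blast)
  qed (rule frob_inner_self_nonneg)
  also have "\<dots> \<longleftrightarrow> (\<lambda>N. (1 / sqrt (1 + 2 * (\<gamma> N / real N))) ^ (N * m N)) \<longlonglongrightarrow> 1"
  proof (rule tendsto_cong)
    show "\<forall>\<^sub>F N in sequentially. (\<integral>\<omega>. exp (- frob_inner (R N \<omega>) (R N \<omega>)) \<partial>Q N)
        = (1 / sqrt (1 + 2 * (\<gamma> N / real N))) ^ (N * m N)"
      using ge1 by eventually_elim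
        (intro prob_space.expectation_exp_frob_inner_gaussian; use ass in simp)
  qed
  also have "\<dots> \<longleftrightarrow> (\<lambda>N. real (N * m N) * (\<gamma> N / real N)) \<longlonglongrightarrow> 0"
  proof (rule tendsto_gaussian_laplace_iff)
    show "\<forall>\<^sub>F N in sequentially. \<gamma> N / real N \<ge> 0"
      using ge1 by eventually_elim (use ass in simp)
  qed
  also have "\<dots> \<longleftrightarrow> (\<lambda>N. \<gamma> N * real (m N)) \<longlonglongrightarrow> 0"
    by (rule tendsto_cong) (use ge1 in eventually_elim, simp)
  finally show ?thesis .
qed

section \<open>Conditioning on generated sigma-algebras, and the unconditional Gaussian law\<close>

lemma generated_sigma_subalgebra:
  assumes "\<And>Y. Y \<in> G \<Longrightarrow> Y \<in> borel_measurable M"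
  shows "subalgebra M (generated_sigma M G)"
  using assms unfolding subalgebra_def generated_sigma_def
  by (subst sets_measure_of)
    (auto simp: space_measure_of_conv intro!: sets.sigma_sets_subset intro: measurable_sets)

lemma measurable_generated_sigma:
  assumes "Y \<in> G"
  shows "Y \<in> borel_measurable (generated_sigma M G)"
proof (rule measurableI)
  fix B :: "real set" assume "B \<in> sets borel"
  then show "Y -` B \<inter> space (generated_sigma M G) \<in> sets (generated_sigma M G)"
    unfolding generated_sigma_def using assms
    by (subst sets_measure_of) (auto intro!: sigma_sets.Basic simp: space_measure_of_conv)
qed simp

text \<open>The tower property. Finiteness of the measure makes the subalgebra sigma-finite, as the
  theory of \<open>real_cond_exp\<close> requires.\<close>

lemma (in prob_space) expectation_cond_prob_given:
  assumes "subalgebra M F" "A \<in> events"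
  shows "integrable M (cond_prob_given M F A)" "expectation (cond_prob_given M F A) = prob A"
proof -
  interpret sigma_finite_subalgebra M F
    using assms(1) by (simp add: finite_measure_subalgebra_is_sigma_finite finite_measure_axioms
        finite_measure_subalgebra_def finite_measure_subalgebra_axioms_def)
  have "integrable M (indicat_real A)"
    using assms(2) by (intro integrable_real_indicator) (auto simp: emeasure_eq_measure)
  from real_cond_exp_int[OF this]
  show "integrable M (cond_prob_given M F A)" "expectation (cond_prob_given M F A) = prob A"
    using assms(2) by (auto simp: cond_prob_given_def)
qed

text \<open>The conditional probability of each rectangle is a deterministic constant, so taking
  expectations gives the same product for the unconditional probability. Product probabilities on
  rectangles determine the marginal laws and the independence.\<close>

lemma (in prob_space) cond_iid_imp_iid_gaussian_entries:
  assumes sub: "subalgebra M F" and R: "random_mat M m n R" and v: "v \<ge> 0"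
    and cond: "cond_iid_gaussian_entries M F m n v R"
  shows "iid_gaussian_entries M m n v R"
proof -
  interpret G: prob_space "centered_gaussian v" by (rule prob_space_centered_gaussian[OF v])
  have meas: "(\<lambda>\<omega>. R \<omega> $$ (i,j)) \<in> borel_measurable M" if "i < m" "j < n" for i j
    using R that by (auto simp: random_mat_def)
  have rect: "prob {\<omega> \<in> space M. \<forall>ij\<in>J. R \<omega> $$ ij \<in> B ij} = (\<Prod>ij\<in>J. G.prob (B ij))"
    if J: "J \<subseteq> {..<m} \<times> {..<n}" and B: "\<And>ij. ij \<in> J \<Longrightarrow> B ij \<in> sets borel" for J B
  proof -
    \<comment> \<open>Entries outside \<open>J\<close> are left unconstrained; they contribute
      factors 1, so the formula for full rectangles also covers subfamilies.\<close>
    define B' where "B' = (\<lambda>ij. if ij \<in> J then B ij else UNIV)"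
    have B': "B' ij \<in> sets borel" for ij using B by (simp add: B'_def)
    define A where "A = {\<omega> \<in> space M. \<forall>i<m. \<forall>j<n. R \<omega> $$ (i,j) \<in> B' (i,j)}"
    have "A = {\<omega> \<in> space M. \<forall>i\<in>{..<m}. \<forall>j\<in>{..<n}. R \<omega> $$ (i,j) \<in> B' (i,j)}"
      by (auto simp: A_def)
    also have "\<dots> \<in> events"
      using B' by (intro sets.sets_Collect_finite_All' measurable_sets_Collect[OF meas] finite_lessThan
          sets.sets_Collect_finite_All) auto
    finally have A: "A \<in> events" .
    have "AE \<omega> in M. cond_prob_given M F A \<omega> = (\<Prod>i<m. \<Prod>j<n. G.prob (B' (i,j)))"
      using cond B' unfolding cond_iid_gaussian_entries_def A_def
      by (auto dest!: spec[of _ "\<lambda>i j. B' (i,j)"])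
    then have "expectation (cond_prob_given M F A) = expectation (\<lambda>_. \<Prod>i<m. \<Prod>j<n. G.prob (B' (i,j)))"
      using expectation_cond_prob_given(1)[OF sub A] by (intro integral_cong_AE) auto
    then have "prob A = (\<Prod>i<m. \<Prod>j<n. G.prob (B' (i,j)))"
      by (simp add: expectation_cond_prob_given(2)[OF sub A] prob_space)
    also have "\<dots> = (\<Prod>ij\<in>{..<m} \<times> {..<n}. G.prob (B' ij))"
      by (simp add: prod.cartesian_product)
    also have "\<dots> = (\<Prod>ij\<in>J. G.prob (B' ij))"
      using J G.prob_space by (intro prod.mono_neutral_right) (auto simp: B'_def)
    also have "\<dots> = (\<Prod>ij\<in>J. G.prob (B ij))" by (simp add: B'_def)
    also have "A = {\<omega> \<in> space M. \<forall>ij\<in>J. R \<omega> $$ ij \<in> B ij}"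
      using J by (auto simp: A_def B'_def)
    finally show ?thesis .
  qed
  have single: "prob {\<omega> \<in> space M. R \<omega> $$ ij \<in> B} = G.prob B"
    if "ij \<in> {..<m} \<times> {..<n}" "B \<in> sets borel" for ij B
    using rect[of "{ij}" "\<lambda>_. B"] that by simp
  have "distr M borel (\<lambda>\<omega>. R \<omega> $$ (i,j)) = centered_gaussian v" if "i < m" "j < n" for i j
  proof (rule measure_eqI)
    fix B assume B: "B \<in> sets (distr M borel (\<lambda>\<omega>. R \<omega> $$ (i,j)))"
    interpret D: prob_space "distr M borel (\<lambda>\<omega>. R \<omega> $$ (i,j))"
      by (intro prob_space_distr meas that)
    have "(\<lambda>\<omega>. R \<omega> $$ (i,j)) -` B \<inter> space M = {\<omega> \<in> space M. R \<omega> $$ (i,j) \<in> B}" by auto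
    then have "measure (distr M borel (\<lambda>\<omega>. R \<omega> $$ (i,j))) B = G.prob B"
      using B that single[of "(i,j)" B] by (simp add: measure_distr meas)
    then show "emeasure (distr M borel (\<lambda>\<omega>. R \<omega> $$ (i,j))) B = emeasure (centered_gaussian v) B"
      by (simp add: D.emeasure_eq_measure G.emeasure_eq_measure)
  qed simp
  moreover have "indep_vars (\<lambda>_. borel) (\<lambda>ij \<omega>. R \<omega> $$ ij) ({..<m} \<times> {..<n})"
    unfolding indep_vars_def2
  proof (intro conjI ballI indep_setsI)
    show "(\<lambda>\<omega>. R \<omega> $$ ij) \<in> borel_measurable M" if "ij \<in> {..<m} \<times> {..<n}" for ij
      using that by (auto intro: meas)
    then show "{(\<lambda>\<omega>. R \<omega> $$ ij) -` A \<inter> space M |A. A \<in> sets borel} \<subseteq> events"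
      if "ij \<in> {..<m} \<times> {..<n}" for ij
      using that by (auto intro: measurable_sets)
    fix A J
    assume J: "J \<noteq> {}" "J \<subseteq> {..<m} \<times> {..<n}"
      and A: "\<forall>ij\<in>J. A ij \<in> {(\<lambda>\<omega>. R \<omega> $$ ij) -` A \<inter> space M |A. A \<in> sets borel}"
    have "\<exists>B. B \<in> sets borel \<and> A ij = {\<omega> \<in> space M. R \<omega> $$ ij \<in> B}" if ij: "ij \<in> J" for ij
    proof -
      obtain B where "B \<in> sets borel" "A ij = (\<lambda>\<omega>. R \<omega> $$ ij) -` B \<inter> space M"
        using A ij by blast
      then show ?thesis by (intro exI[of _ B]) auto
    qed
    then have "\<forall>ij\<in>J. \<exists>B. B \<in> sets borel \<and> A ij = {\<omega> \<in> space M. R \<omega> $$ ij \<in> B}" by simp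
    from bchoice[OF this] obtain B where B: "\<And>ij. ij \<in> J \<Longrightarrow> B ij \<in> sets borel"
      "\<And>ij. ij \<in> J \<Longrightarrow> A ij = {\<omega> \<in> space M. R \<omega> $$ ij \<in> B ij}"
      by blast
    \<comment> \<open>\<open>J\<close> is nonempty, which keeps the intersection inside
      \<open>space M\<close>.\<close>
    have "(\<Inter>ij\<in>J. A ij) = {\<omega> \<in> space M. \<forall>ij\<in>J. R \<omega> $$ ij \<in> B ij}"
      using J(1) B(2) by auto
    moreover have "(\<Prod>ij\<in>J. prob (A ij)) = (\<Prod>ij\<in>J. G.prob (B ij))"
      using J(2) B single by (intro prod.cong) (auto simp: subset_iff)
    ultimately show "prob (\<Inter>ij\<in>J. A ij) = (\<Prod>ij\<in>J. prob (A ij))"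
      using rect[OF J(2) B(1)] by simp
  qed
  ultimately show ?thesis
    by (simp add: iid_gaussian_entries_def case_prod_unfold)
qed

section \<open>The maximum norm and the loss\<close>

lemma max_norm_nonneg: "max_norm v \<ge> 0"
  by (simp add: max_norm_def)

lemma abs_le_max_norm: "i < dim_vec v \<Longrightarrow> \<bar>v $ i\<bar> \<le> max_norm v"
  unfolding max_norm_def by (intro Max_ge) auto

lemma max_norm_le: "(\<And>i. i < dim_vec v \<Longrightarrow> \<bar>v $ i\<bar> \<le> b) \<Longrightarrow> b \<ge> 0 \<Longrightarrow> max_norm v \<le> b"
  unfolding max_norm_def by (intro Max.boundedI) auto

lemma max_norm_smult_le: "max_norm (c \<cdot>\<^sub>v v) \<le> \<bar>c\<bar> * max_norm v"
  by (intro max_norm_le) (auto simp: abs_mult max_norm_nonneg intro!: mult_left_mono abs_le_max_norm)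

text \<open>\<open>enn2real\<close> sends infinity to 0, so finiteness is what makes the real
  constant a bound. Coinciding points do not enter the supremum and are treated apart; distinct
  vectors of equal dimension have positive distance, so the quotient can be cleared.\<close>

lemma max_lipschitz_bound:
  assumes "max_lipschitz U f < \<infinity>" "v \<in> U" "w \<in> U" "v \<in> carrier_vec n" "w \<in> carrier_vec n"
  shows "max_norm (f v - f w) \<le> enn2real (max_lipschitz U f) * max_norm (v - w)"
proof (cases "v = w")
  case True
  then have "max_norm (f v - f w) \<le> 0" by (intro max_norm_le) auto
  then show ?thesis by (smt (verit) enn2real_nonneg max_norm_nonneg mult_nonneg_nonneg)
next
  case False
  then obtain i where i: "i < n" "v $ i \<noteq> w $ i"
    using assms(4,5) by (metis carrier_vecD eq_vecI)
  have "0 < \<bar>(v - w) $ i\<bar>" using i assms by simp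
  also have "\<dots> \<le> max_norm (v - w)" using i assms by (intro abs_le_max_norm) simp
  finally have pos: "max_norm (v - w) > 0" .
  have "ennreal (max_norm (f v - f w) / max_norm (v - w)) \<le> max_lipschitz U f"
    unfolding max_lipschitz_def using assms False by (intro SUP_upper2[of "(v, w)"]) auto
  then have "enn2real (ennreal (max_norm (f v - f w) / max_norm (v - w))) \<le> enn2real (max_lipschitz U f)"
    using assms(1) by (intro enn2real_mono) (auto simp: infinity_ennreal_def)
  then have "max_norm (f v - f w) / max_norm (v - w) \<le> enn2real (max_lipschitz U f)"
    by (subst (asm) enn2real_ennreal) (auto simp: max_norm_nonneg)
  then show ?thesis using pos by (simp add: pos_divide_le_eq)
qed

text \<open>The logarithm of a softmax entry is a coordinate minus a log-sum-exp term. Each of the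
  two changes by at most the max-norm distance, which explains the factor 2.\<close>

lemma ln_softmax_diff_le:
  assumes v: "v \<in> carrier_vec K" and w: "w \<in> carrier_vec K" and c: "c < K"
  shows "ln (softmax v $ c) - ln (softmax w $ c) \<le> 2 * max_norm (v - w)"
proof -
  let ?Z = "\<lambda>u :: real vec. \<Sum>j<K. exp (u $ j)"
  have Z: "?Z u > 0" for u
    using c by (intro sum_pos) auto
  have ln: "ln (softmax u $ c) = u $ c - ln (?Z u)" if "u \<in> carrier_vec K" for u
    using that c Z[of u] by (simp add: softmax_def ln_div)
  have diff: "\<bar>v $ j - w $ j\<bar> \<le> max_norm (v - w)" if "j < K" for j
    using abs_le_max_norm[of j "v - w"] that v w by simp
  \<comment> \<open>Each exponential grows by at most the factor
    \<open>exp (max_norm (v - w))\<close>, hence so does their sum.\<close>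
  have "?Z w \<le> (\<Sum>j<K. exp (max_norm (v - w)) * exp (v $ j))"
    using diff by (intro sum_mono) (force simp flip: exp_add)
  also have "\<dots> = exp (max_norm (v - w)) * ?Z v" by (simp add: sum_distrib_left)
  finally have "ln (?Z w) \<le> ln (exp (max_norm (v - w)) * ?Z v)"
    using Z by (subst ln_le_cancel_iff) auto
  also have "\<dots> = max_norm (v - w) + ln (?Z v)"
    using Z[of v] by (subst ln_mult) auto
  finally show ?thesis
    using diff[OF c] ln[OF v] ln[OF w] by linarith
qed

lemma frob_norm_square_add_smult:
  assumes "A \<in> carrier_mat m n" "B \<in> carrier_mat m n"
  shows "(frob_norm (A + c \<cdot>\<^sub>m B))\<^sup>2 = (frob_norm A)\<^sup>2 + 2 * c * frob_inner A B + c\<^sup>2 * (frob_norm B)\<^sup>2"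
proof -
  have "(frob_norm (A + c \<cdot>\<^sub>m B))\<^sup>2
      = (\<Sum>i<m. \<Sum>j<n. (A $$ (i,j) + c * B $$ (i,j)) * (A $$ (i,j) + c * B $$ (i,j)))"
    unfolding frob_norm_square using assms by (subst frob_inner_carrier[of _ m n]) auto
  also have "\<dots> = (\<Sum>i<m. \<Sum>j<n. A $$ (i,j) * A $$ (i,j) + 2 * c * (A $$ (i,j) * B $$ (i,j))
      + c\<^sup>2 * (B $$ (i,j) * B $$ (i,j)))"
    by (intro sum.cong refl) (simp add: algebra_simps power2_eq_square)
  finally show ?thesis
    unfolding frob_norm_square frob_inner_carrier[OF assms(1)] frob_inner_carrier[OF assms(2)]
    by (simp add: sum.distrib sum_distrib_left)
qed

text \<open>Along the path that scales the perturbation, the layer output moves only in the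
  direction \<open>B *\<^sub>v x\<close>, the quantity controlled by hypothesis (iv).\<close>

lemma mult_mat_vec_diff_smult:
  fixes A B :: "real mat"
  assumes "A \<in> carrier_mat m n" "B \<in> carrier_mat m n" "x \<in> carrier_vec n"
  shows "(A + a \<cdot>\<^sub>m B) *\<^sub>v x - (A + b \<cdot>\<^sub>m B) *\<^sub>v x = (a - b) \<cdot>\<^sub>v (B *\<^sub>v x)"
proof -
  have "(A + c \<cdot>\<^sub>m B) *\<^sub>v x = A *\<^sub>v x + c \<cdot>\<^sub>v (B *\<^sub>v x)" for c
    using assms by (subst add_mult_distrib_mat_vec[of _ m n]) (auto intro!: eq_vecI)
  then show ?thesis
    using assms by (intro eq_vecI) (auto simp: algebra_simps)
qed

section \<open>From near-stationarity of the loss to the decay of the variance scale\<close>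

theorem corollary4p9:
  fixes M :: "nat \<Rightarrow> 'a measure"
    and T :: "'s set" and C :: "'s \<Rightarrow> nat" and K :: nat and lam :: real
    and p :: "nat \<Rightarrow> nat" and nr nc :: "nat \<Rightarrow> nat \<Rightarrow> nat" and q l :: "nat \<Rightarrow> nat"
    and X :: "nat \<Rightarrow> 's \<Rightarrow> params \<Rightarrow> real vec"
    and \<alpha> :: "real \<Rightarrow> nat \<Rightarrow> 'a \<Rightarrow> params" and \<alpha>lim :: "nat \<Rightarrow> 'a \<Rightarrow> params"
    and S R :: "nat \<Rightarrow> 'a \<Rightarrow> real mat"
    and \<psi>1 :: "nat \<Rightarrow> 'a \<Rightarrow> 's \<Rightarrow> real vec" and \<psi>2 :: "nat \<Rightarrow> 'a \<Rightarrow> real vec \<Rightarrow> real vec"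
    and g :: "nat \<Rightarrow> real"
    and U :: "nat \<Rightarrow> 'a \<Rightarrow> 's \<Rightarrow> real vec set"
    and d1 d2 :: "nat \<Rightarrow> real" and J :: "nat \<Rightarrow> real vec \<Rightarrow> real"
    and \<epsilon> :: "nat \<Rightarrow> 'a \<Rightarrow> real"
  defines "\<F> \<equiv> (\<lambda>N. layer_sigma (M N) N K (S N) (\<psi>1 N) (\<psi>2 N))"
    and "Loss \<equiv> (\<lambda>N. loss T C lam {1..p N} (X N))"
    and "\<alpha>\<theta> \<equiv> (\<lambda>N \<theta> \<omega>. set_layer (l N) (S N \<omega> + \<theta> \<cdot>\<^sub>m R N \<omega>) (\<alpha>lim N \<omega>))"
    and "Lip \<equiv> (\<lambda>N \<omega> s. max_lipschitz (U N \<omega> s) (\<psi>2 N \<omega>))"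
  assumes T: "finite T" "T \<noteq> {}" "\<And>s. s \<in> T \<Longrightarrow> C s < K"
    and lam: "lam > 0"
    and prob: "\<And>N. N \<ge> 1 \<Longrightarrow> prob_space (M N)"
    and layer: "\<And>N. N \<ge> 1 \<Longrightarrow> l N \<in> {1..p N} \<and> nr N (l N) = N \<and> nc N (l N) = N"
    and logits: "\<And>N s a. N \<ge> 1 \<Longrightarrow> a \<in> params_carrier {1..p N} (nr N) (nc N) (q N)
                   \<Longrightarrow> X N s a \<in> carrier_vec K"
    \<comment> \<open>(i)\<close>
    and path: "\<And>N t. N \<ge> 1 \<Longrightarrow> t \<ge> 0 \<Longrightarrow> random_params (M N) {1..p N} (nr N) (nc N) (q N) (\<alpha> t N)"
    and limit: "\<And>N. N \<ge> 1 \<Longrightarrow> random_params (M N) {1..p N} (nr N) (nc N) (q N) (\<alpha>lim N)"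
    and training: "\<And>N. N \<ge> 1 \<Longrightarrow>
          tends_to_0_in_prob (\<lambda>_. M N) (\<lambda>t \<omega>. params_dist {1..p N} (\<alpha> t N \<omega>) (\<alpha>lim N \<omega>)) at_top"
    and SR: "\<And>N. N \<ge> 1 \<Longrightarrow> random_mat (M N) N N (S N) \<and> random_mat (M N) N N (R N)"
    and decomposition: "\<And>N. N \<ge> 1 \<Longrightarrow> AE \<omega> in M N. fst (\<alpha>lim N \<omega>) (l N) = S N \<omega> + R N \<omega>"
    and psi1: "\<And>N s. N \<ge> 1 \<Longrightarrow> random_vec (M N) N (\<lambda>\<omega>. \<psi>1 N \<omega> s)"
    and psi2: "\<And>N v. N \<ge> 1 \<Longrightarrow> v \<in> carrier_vec N \<Longrightarrow> random_vec (M N) K (\<lambda>\<omega>. \<psi>2 N \<omega> v)"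
    and factorization: "\<And>N. N \<ge> 1 \<Longrightarrow> AE \<omega> in M N. \<forall>s. \<forall>\<theta>\<in>{0..1}.
          softmax (X N s (\<alpha>\<theta> N \<theta> \<omega>))
          = softmax (\<psi>2 N \<omega> ((S N \<omega> + \<theta> \<cdot>\<^sub>m R N \<omega>) *\<^sub>v \<psi>1 N \<omega> s))"
    \<comment> \<open>(ii)\<close>
    and g_nonneg: "\<And>N. N \<ge> 1 \<Longrightarrow> g N \<ge> 0"
    and gaussian: "\<And>N. N \<ge> 1 \<Longrightarrow> cond_iid_gaussian_entries (M N) (\<F> N) N N (g N / real N) (R N)"
    \<comment> \<open>(iii)\<close>
    and lipschitz: "\<And>N. N \<ge> 1 \<Longrightarrow> AE \<omega> in M N. \<forall>s\<in>T.
          U N \<omega> s \<subseteq> carrier_vec N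
          \<and> (\<forall>\<theta>\<in>{0..1}. (S N \<omega> + \<theta> \<cdot>\<^sub>m R N \<omega>) *\<^sub>v \<psi>1 N \<omega> s \<in> U N \<omega> s)
          \<and> Lip N \<omega> s < \<infinity>"
    \<comment> \<open>(iv)\<close>
    and d1: "\<And>N. N \<ge> 1 \<Longrightarrow> d1 N \<ge> 0" "d1 \<longlonglongrightarrow> 0"
    and d2: "\<And>N. N \<ge> 1 \<Longrightarrow> d2 N \<ge> 0" "d2 \<longlonglongrightarrow> 0"
    and J_nonneg: "\<And>N v. N \<ge> 1 \<Longrightarrow> v \<in> carrier_vec N \<Longrightarrow> J N v \<ge> 0"
    and tail: "\<And>N v. N \<ge> 1 \<Longrightarrow> random_vec (\<F> N) N v \<Longrightarrow>
          {\<omega> \<in> space (M N). max_norm (R N \<omega> *\<^sub>v v \<omega>) > d1 N * J N (v \<omega>)} \<in> sets (M N)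
          \<and> (AE \<omega> in M N. cond_prob_given (M N) (\<F> N)
                {\<omega> \<in> space (M N). max_norm (R N \<omega> *\<^sub>v v \<omega>) > d1 N * J N (v \<omega>)} \<omega> \<le> d2 N)"
    \<comment> \<open>(v)\<close>
    and a_phi: "\<And>s. s \<in> T \<Longrightarrow> tends_to_0_in_prob M
          (\<lambda>N \<omega>. J N (\<psi>1 N \<omega> s) * enn2real (Lip N \<omega> s) * d1 N) sequentially"
    \<comment> \<open>(vi)\<close>
    and inner: "tends_to_0_in_prob M (\<lambda>N \<omega>. frob_inner (S N \<omega>) (R N \<omega>)) sequentially"
    \<comment> \<open>(vii)\<close>
    and eps_nonneg: "\<And>N \<omega>. N \<ge> 1 \<Longrightarrow> \<omega> \<in> space (M N) \<Longrightarrow> \<epsilon> N \<omega> \<ge> 0"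
    and eps: "tends_to_0_in_prob M \<epsilon> sequentially"
    and stationarity: "(\<lambda>N. measure (M N) {\<omega> \<in> space (M N).
            Liminf (at_right 0)
              (\<lambda>h. ereal ((Loss N (\<alpha>\<theta> N (1 - h) \<omega>) - Loss N (\<alpha>lim N \<omega>)) / h))
            \<ge> ereal (- \<epsilon> N \<omega>)}) \<longlonglongrightarrow> 1"
  shows "((\<lambda>N. g N * real N) \<longlonglongrightarrow> 0)
    \<and> (\<forall>N\<ge>1. mp_singular_edge N N (g N / real N) = 2 * sqrt (g N))
    \<and> ((\<lambda>N. mp_singular_edge N N (g N / real N)) \<longlonglongrightarrow> 0)
    \<and> (\<forall>(Q :: nat \<Rightarrow> 'b measure) (m :: nat \<Rightarrow> nat) (R' :: nat \<Rightarrow> 'b \<Rightarrow> real mat) (\<gamma> :: nat \<Rightarrow> real).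
         (\<forall>N\<ge>1. prob_space (Q N) \<and> \<gamma> N \<ge> 0 \<and> random_mat (Q N) N (m N) (R' N)
                  \<and> iid_gaussian_entries (Q N) N (m N) (\<gamma> N / real N) (R' N))
         \<longrightarrow> (tends_to_0_in_prob Q (\<lambda>N \<omega>. frob_norm (R' N \<omega>)) sequentially
              \<longleftrightarrow> (\<lambda>N. \<gamma> N * real (m N)) \<longlonglongrightarrow> 0))
    \<and> (\<forall>(m :: nat \<Rightarrow> nat) (\<gamma> :: nat \<Rightarrow> real) (c :: real).
         (\<forall>N\<ge>1. \<gamma> N \<ge> 0) \<and> c > 0 \<and> (\<lambda>N. real (m N) / real N) \<longlonglongrightarrow> c
         \<longrightarrow> ((\<lambda>N. \<gamma> N * real (m N)) \<longlonglongrightarrow> 0 \<longleftrightarrow> (\<lambda>N. \<gamma> N * real N) \<longlonglongrightarrow> 0))"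
proof -
  note ge1 = eventually_ge_at_top[of "1::nat"]
  have prob_ev: "\<forall>\<^sub>F N in sequentially. prob_space (M N)"
    using ge1 by eventually_elim (rule prob)
  define a where "a = (\<lambda>N \<omega> s. J N (\<psi>1 N \<omega> s) * enn2real (Lip N \<omega> s) * d1 N)"
  define stat where "stat = (\<lambda>N. {\<omega> \<in> space (M N).
            Liminf (at_right 0)
              (\<lambda>h. ereal ((Loss N (\<alpha>\<theta> N (1 - h) \<omega>) - Loss N (\<alpha>lim N \<omega>)) / h))
            \<ge> ereal (- \<epsilon> N \<omega>)})"
  define bad where "bad = (\<lambda>N s. {\<omega> \<in> space (M N).
            max_norm (R N \<omega> *\<^sub>v \<psi>1 N \<omega> s) > d1 N * J N (\<psi>1 N \<omega> s)})"
  \<comment> \<open>On \<open>good N\<close> the near-stationarity inequality holds together with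
    the bound on \<open>R N \<omega> *\<^sub>v \<psi>1 N \<omega> s\<close> for every training
    point.\<close>
  define good where "good = (\<lambda>N. stat N - (\<Union>s\<in>T. bad N s))"
  \<comment> \<open>This is what remains when the near-stationarity inequality, in the limit of
    vanishing \<open>h\<close>, is solved for the squared Frobenius norm of
    \<open>R\<close>.\<close>
  define Z where "Z = (\<lambda>N \<omega>. (\<epsilon> N \<omega> + 2 / card T * (\<Sum>s\<in>T. a N \<omega> s)
            + (- 2 * lam) * frob_inner (S N \<omega>) (R N \<omega>)) / (2 * lam))"
  have sub: "subalgebra (M N) (\<F> N)" if "N \<ge> 1" for N
    unfolding \<F>_def layer_sigma_def
    using SR[OF that] psi1[OF that] psi2[OF that]
    by (intro generated_sigma_subalgebra) (auto simp: random_mat_def random_vec_def)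
  \<comment> \<open>Hypothesis (iv) will be applied with \<open>v\<close> equal to
    \<open>\<psi>1\<close> at a training point, which has to be measurable with respect to the
    conditioning sigma-algebra.\<close>
  have psi1_\<F>: "random_vec (\<F> N) N (\<lambda>\<omega>. \<psi>1 N \<omega> s)" if "N \<ge> 1" for N s
    unfolding random_vec_def
  proof (intro conjI ballI allI impI)
    show "\<psi>1 N \<omega> s \<in> carrier_vec N" if "\<omega> \<in> space (\<F> N)" for \<omega>
      using psi1[OF \<open>N \<ge> 1\<close>, of s] sub[OF \<open>N \<ge> 1\<close>] that by (simp add: random_vec_def subalgebra_def)
    show "(\<lambda>\<omega>. \<psi>1 N \<omega> s $ i) \<in> borel_measurable (\<F> N)" if "i < N" for i
      unfolding \<F>_def layer_sigma_def using that by (intro measurable_generated_sigma) auto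
  qed
  have bad: "bad N s \<in> sets (M N)" "measure (M N) (bad N s) \<le> d2 N" if N: "N \<ge> 1" for N s
  proof -
    interpret prob_space "M N" by (rule prob[OF N])
    note tail = tail[OF N psi1_\<F>[OF N], of s]
    show b: "bad N s \<in> sets (M N)" using tail by (simp add: bad_def)
    \<comment> \<open>Integrating the almost sure conditional bound gives an unconditional
      one.\<close>
    have "expectation (cond_prob_given (M N) (\<F> N) (bad N s)) \<le> expectation (\<lambda>_. d2 N)"
      using tail expectation_cond_prob_given(1)[OF sub[OF N] b]
      by (intro integral_mono_AE) (auto simp: bad_def)
    then show "prob (bad N s) \<le> d2 N"
      by (simp add: expectation_cond_prob_given(2)[OF sub[OF N] b] prob_space)
  qed
  have stat_lim: "(\<lambda>N. measure (M N) (stat N)) \<longlonglongrightarrow> 1"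
    using stationarity by (simp add: stat_def)
  \<comment> \<open>\<open>measure\<close> is 0 on non-measurable sets, so a probability tending to
    1 forces \<open>stat N\<close> to be measurable for large \<open>N\<close>.\<close>
  have stat_sets: "\<forall>\<^sub>F N in sequentially. stat N \<in> sets (M N)"
    using order_tendstoD(1)[OF stat_lim, of 0, simplified]
    by eventually_elim (use measure_notin_sets in force)
  have good_sets: "\<forall>\<^sub>F N in sequentially. good N \<in> sets (M N)"
    using stat_sets ge1
    unfolding good_def by eventually_elim (intro sets.Diff sets.finite_UN bad T(1))
  have good_lim: "(\<lambda>N. measure (M N) (good N)) \<longlonglongrightarrow> 1"
  proof (rule tendsto_sandwich[OF _ _ _ tendsto_const])
    show "\<forall>\<^sub>F N in sequentially. measure (M N) (good N) \<le> 1"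
      using prob_ev by eventually_elim (rule prob_space.prob_le_1)
    show "\<forall>\<^sub>F N in sequentially. measure (M N) (stat N) - card T * d2 N \<le> measure (M N) (good N)"
      using stat_sets ge1 prob_ev
    proof eventually_elim
      case (elim N)
      interpret prob_space "M N" by fact
      have un: "(\<Union>s\<in>T. bad N s) \<in> sets (M N)"
        using T(1) elim bad by (intro sets.finite_UN) auto
      \<comment> \<open>A union bound over the training set; its size is fixed, so the loss
        \<open>card T * d2 N\<close> vanishes.\<close>
      have "prob (\<Union>s\<in>T. bad N s) \<le> (\<Sum>s\<in>T. prob (bad N s))"
        using T(1) elim bad by (intro measure_subadditive_finite) auto
      also have "\<dots> \<le> card T * d2 N"
        using sum_bounded_above[of T "\<lambda>s. prob (bad N s)" "d2 N"] bad elim by simp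
      finally have "prob (\<Union>s\<in>T. bad N s) \<le> card T * d2 N" .
      moreover have "prob (stat N) \<le> prob (good N \<union> (\<Union>s\<in>T. bad N s))"
        using un elim by (intro finite_measure_mono) (auto simp: good_def)
      moreover have "\<dots> \<le> prob (good N) + prob (\<Union>s\<in>T. bad N s)"
        using un elim by (intro measure_subadditive) (auto simp: good_def)
      ultimately show ?case by linarith
    qed
    have "(\<lambda>N. measure (M N) (stat N) - card T * d2 N) \<longlonglongrightarrow> 1 - real (card T) * 0"
      by (intro tendsto_intros stat_lim d2)
    then show "(\<lambda>N. measure (M N) (stat N) - card T * d2 N) \<longlonglongrightarrow> 1" by simp
  qed
  have Z: "tends_to_0_in_prob M Z sequentially"
    unfolding Z_def divide_inverse mult.commute[of _ "inverse (2 * lam)"]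
    unfolding a_def
    by (intro tends_to_0_in_prob_cmult tends_to_0_in_prob_add tends_to_0_in_prob_sum
        prob_ev T(1) eps inner a_phi)
  have bound: "\<forall>\<^sub>F N in sequentially. AE \<omega> in M N. \<omega> \<in> good N \<longrightarrow> \<bar>frob_inner (R N \<omega>) (R N \<omega>)\<bar> \<le> \<bar>Z N \<omega>\<bar>"
    using ge1
  proof eventually_elim
    case (elim N)
    from decomposition[OF elim] factorization[OF elim] lipschitz[OF elim] AE_space
    show ?case
    proof (eventually_elim, intro impI)
      fix \<omega>
      assume dec: "fst (\<alpha>lim N \<omega>) (l N) = S N \<omega> + R N \<omega>"
        and fac: "\<forall>s. \<forall>\<theta>\<in>{0..1}. softmax (X N s (\<alpha>\<theta> N \<theta> \<omega>))
          = softmax (\<psi>2 N \<omega> ((S N \<omega> + \<theta> \<cdot>\<^sub>m R N \<omega>) *\<^sub>v \<psi>1 N \<omega> s))"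
        and lip: "\<forall>s\<in>T. U N \<omega> s \<subseteq> carrier_vec N
          \<and> (\<forall>\<theta>\<in>{0..1}. (S N \<omega> + \<theta> \<cdot>\<^sub>m R N \<omega>) *\<^sub>v \<psi>1 N \<omega> s \<in> U N \<omega> s)
          \<and> Lip N \<omega> s < \<infinity>"
        and \<omega>: "\<omega> \<in> space (M N)" and good: "\<omega> \<in> good N"
      have S: "S N \<omega> \<in> carrier_mat N N" and R: "R N \<omega> \<in> carrier_mat N N"
        and psi1: "\<And>s. \<psi>1 N \<omega> s \<in> carrier_vec N"
        and psi2: "\<And>v. v \<in> carrier_vec N \<Longrightarrow> \<psi>2 N \<omega> v \<in> carrier_vec K"
        using SR[OF elim] psi1[OF elim] psi2[OF elim] \<omega> by (auto simp: random_mat_def random_vec_def)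
      define u where "u = (\<lambda>\<theta> s. (S N \<omega> + \<theta> \<cdot>\<^sub>m R N \<omega>) *\<^sub>v \<psi>1 N \<omega> s)"
      have u: "u \<theta> s \<in> carrier_vec N" for \<theta> s
        unfolding u_def by (intro mult_mat_vec_carrier[OF _ psi1] add_carrier_mat smult_carrier_mat R)
      \<comment> \<open>The data term along the path. The factorization identifies softmax outputs,
        not logits, and these are all that the loss sees.\<close>
      define D where "D = (\<lambda>\<theta>. - (1 / real (card T)) * (\<Sum>s\<in>T. ln (softmax (\<psi>2 N \<omega> (u \<theta> s)) $ C s)))"
      \<comment> \<open>The layers other than \<open>l N\<close> are constant along the path, so
        \<open>rest\<close> cancels in differences of the loss.\<close>
      define rest where "rest = (\<Sum>i\<in>{1..p N} - {l N}. (frob_norm (fst (\<alpha>lim N \<omega>) i))\<^sup>2)"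
      let ?SR = "frob_inner (S N \<omega>) (R N \<omega>)" and ?RR = "frob_inner (R N \<omega>) (R N \<omega>)"
      have loss: "Loss N (\<alpha>\<theta> N \<theta> \<omega>) = D \<theta>
          + lam * ((frob_norm (S N \<omega>))\<^sup>2 + 2 * \<theta> * ?SR + \<theta>\<^sup>2 * ?RR + rest)"
        if "\<theta> \<in> {0..1}" for \<theta>
      proof -
        have "(\<Sum>i\<in>{1..p N}. (frob_norm (fst (\<alpha>\<theta> N \<theta> \<omega>) i))\<^sup>2)
            = (frob_norm (S N \<omega> + \<theta> \<cdot>\<^sub>m R N \<omega>))\<^sup>2 + rest"
          using layer[OF elim] unfolding rest_def
          by (subst sum.remove[of _ "l N"]) (auto simp: \<alpha>\<theta>_def set_layer_def intro!: sum.cong)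
        then show ?thesis
          using fac that
          by (simp add: Loss_def loss_def D_def u_def frob_norm_square_add_smult[OF S R] frob_norm_square[of "R N \<omega>"])
      qed
      have "S N \<omega> + 1 \<cdot>\<^sub>m R N \<omega> = S N \<omega> + R N \<omega>"
        using S R by (intro eq_matI) auto
      \<comment> \<open>By \<open>dec\<close>, the endpoint \<open>\<theta> = 1\<close> overwrites
        layer \<open>l N\<close> with the value it already has.\<close>
      then have one: "\<alpha>\<theta> N 1 \<omega> = \<alpha>lim N \<omega>"
        by (simp add: \<alpha>\<theta>_def set_layer_def flip: dec)
      \<comment> \<open>The factors are 2 from the log-softmax, \<open>Lip\<close> from
        \<open>\<psi>2\<close>, \<open>h\<close> from the increment along the path, and
        \<open>d1 N * J N (\<psi>1 N \<omega> s)\<close> from being outside \<open>bad N s\<close>;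
        then the average over \<open>T\<close> is taken.\<close>
      have D: "D (1 - h) - D 1 \<le> h * (2 / card T * (\<Sum>s\<in>T. a N \<omega> s))" if h: "0 < h" "h < 1" for h
      proof -
        have "ln (softmax (\<psi>2 N \<omega> (u 1 s)) $ C s) - ln (softmax (\<psi>2 N \<omega> (u (1 - h) s)) $ C s)
            \<le> 2 * (h * a N \<omega> s)" if s: "s \<in> T" for s
        proof -
          have "ln (softmax (\<psi>2 N \<omega> (u 1 s)) $ C s) - ln (softmax (\<psi>2 N \<omega> (u (1 - h) s)) $ C s)
              \<le> 2 * max_norm (\<psi>2 N \<omega> (u 1 s) - \<psi>2 N \<omega> (u (1 - h) s))"
            by (intro ln_softmax_diff_le[of _ K] psi2 u T s)
          also have "max_norm (\<psi>2 N \<omega> (u 1 s) - \<psi>2 N \<omega> (u (1 - h) s))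
              \<le> enn2real (Lip N \<omega> s) * max_norm (u 1 s - u (1 - h) s)"
            using lip s h unfolding Lip_def
            by (intro max_lipschitz_bound[OF _ _ _ u u]) (auto simp: u_def)
          also have "u 1 s - u (1 - h) s = h \<cdot>\<^sub>v (R N \<omega> *\<^sub>v \<psi>1 N \<omega> s)"
            unfolding u_def mult_mat_vec_diff_smult[OF S R psi1] by simp
          also have "enn2real (Lip N \<omega> s) * max_norm \<dots>
              \<le> enn2real (Lip N \<omega> s) * (h * max_norm (R N \<omega> *\<^sub>v \<psi>1 N \<omega> s))"
            using max_norm_smult_le[of h "R N \<omega> *\<^sub>v \<psi>1 N \<omega> s"] h
            by (intro mult_left_mono) auto
          also have "\<dots> \<le> enn2real (Lip N \<omega> s) * (h * (d1 N * J N (\<psi>1 N \<omega> s)))"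
            using good s h \<omega> by (intro mult_left_mono) (auto simp: good_def bad_def not_less)
          also have "\<dots> = h * a N \<omega> s" by (simp add: a_def)
          finally show ?thesis by simp
        qed
        then have "(\<Sum>s\<in>T. ln (softmax (\<psi>2 N \<omega> (u 1 s)) $ C s) - ln (softmax (\<psi>2 N \<omega> (u (1 - h) s)) $ C s))
            \<le> (\<Sum>s\<in>T. 2 * (h * a N \<omega> s))"
          by (rule sum_mono)
        then have "(\<Sum>s\<in>T. ln (softmax (\<psi>2 N \<omega> (u 1 s)) $ C s) - ln (softmax (\<psi>2 N \<omega> (u (1 - h) s)) $ C s)) / card T
            \<le> (\<Sum>s\<in>T. 2 * (h * a N \<omega> s)) / card T"
          by (rule divide_right_mono) simp
        also have "\<dots> = h * (2 / card T * (\<Sum>s\<in>T. a N \<omega> s))"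
          by (simp add: sum_distrib_left[symmetric])
        finally show ?thesis
          by (simp add: D_def sum_subtractf diff_divide_distrib)
      qed
      \<comment> \<open>The regulariser contributes \<open>1 - (1 - h) = h\<close> to the cross term
        and \<open>1 - (1 - h)\<^sup>2 = h * (2 - h)\<close> to the quadratic one; both have been
        divided by \<open>h\<close>.\<close>
      let ?slope = "\<lambda>h. 2 / card T * (\<Sum>s\<in>T. a N \<omega> s) - lam * (2 * ?SR + (2 - h) * ?RR)"
      have slope: "(Loss N (\<alpha>\<theta> N (1 - h) \<omega>) - Loss N (\<alpha>lim N \<omega>)) / h \<le> ?slope h"
        if h: "0 < h" "h < 1" for h
      proof -
        have "Loss N (\<alpha>\<theta> N (1 - h) \<omega>) - Loss N (\<alpha>lim N \<omega>)
            = D (1 - h) - D 1 - h * (lam * (2 * ?SR + (2 - h) * ?RR))"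
          using h loss[of "1 - h"] loss[of 1] by (simp add: one algebra_simps power2_eq_square)
        also have "\<dots> \<le> ?slope h * h"
          using D[OF h] by (simp add: algebra_simps)
        finally show ?thesis using h by (simp add: pos_divide_le_eq)
      qed
      \<comment> \<open>The upper bound is continuous in \<open>h\<close>, so its lower limit is its
        value at 0, where the quadratic term has coefficient \<open>- 2 * lam\<close>.\<close>
      have "((\<lambda>h. ereal (?slope h)) \<longlongrightarrow> ereal (?slope 0)) (at_right 0)"
        by (intro tendsto_intros)
      then have lim: "Liminf (at_right 0) (\<lambda>h. ereal (?slope h)) = ereal (?slope 0)"
        by (intro lim_imp_Liminf) auto
      have "ereal (- \<epsilon> N \<omega>) \<le> Liminf (at_right 0)
          (\<lambda>h. ereal ((Loss N (\<alpha>\<theta> N (1 - h) \<omega>) - Loss N (\<alpha>lim N \<omega>)) / h))"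
        using good by (simp add: good_def stat_def)
      also have "\<dots> \<le> Liminf (at_right 0) (\<lambda>h. ereal (?slope h))"
      proof (rule Liminf_mono)
        \<comment> \<open>Only \<open>0 < h < 1\<close> matters near 0, which keeps
          \<open>1 - h\<close> within the parameter range of the path.\<close>
        have "\<forall>\<^sub>F h in at_right (0::real). h < 1"
          by (rule order_tendstoD(2)[OF tendsto_ident_at]) simp
        then show "\<forall>\<^sub>F h in at_right 0. ereal ((Loss N (\<alpha>\<theta> N (1 - h) \<omega>) - Loss N (\<alpha>lim N \<omega>)) / h)
            \<le> ereal (?slope h)"
          using eventually_at_right_less[of "0::real"] by eventually_elim (use slope in simp)
      qed
      finally have "- \<epsilon> N \<omega> \<le> ?slope 0" unfolding lim by simp
      then have "?RR * (2 * lam) \<le> \<epsilon> N \<omega> + 2 / card T * (\<Sum>s\<in>T. a N \<omega> s) + (- 2 * lam) * ?SR"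
        by (simp add: algebra_simps)
      then have "?RR \<le> Z N \<omega>"
        using lam by (simp only: Z_def pos_le_divide_eq)
      \<comment> \<open>\<open>Z\<close> may be negative elsewhere, but here it dominates a
        nonnegative number, so absolute values can be inserted.\<close>
      then show "\<bar>?RR\<bar> \<le> \<bar>Z N \<omega>\<bar>"
        using frob_inner_self_nonneg[of "R N \<omega>"] by linarith
    qed
  qed
  have R_meas: "(\<lambda>\<omega>. frob_inner (R N \<omega>) (R N \<omega>)) \<in> borel_measurable (M N)"
    "(\<lambda>\<omega>. frob_norm (R N \<omega>)) \<in> borel_measurable (M N)" if "N \<ge> 1" for N
    using conjunct2[OF SR[OF that]] by (auto intro: frob_inner_measurable frob_norm_measurable)
  have "tends_to_0_in_prob M (\<lambda>N \<omega>. frob_inner (R N \<omega>) (R N \<omega>)) sequentially"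
  proof (rule tends_to_0_in_prob_dominated[where Z = Z and A = good])
    show "\<forall>\<^sub>F N in sequentially. (\<lambda>\<omega>. frob_inner (R N \<omega>) (R N \<omega>)) \<in> borel_measurable (M N)"
      using ge1 by eventually_elim (rule R_meas)
  qed (fact prob_ev Z good_sets good_lim bound)+
  moreover have "\<forall>\<^sub>F N in sequentially. (\<lambda>\<omega>. frob_norm (R N \<omega>)) \<in> borel_measurable (M N)"
    using ge1 by eventually_elim (rule R_meas)
  ultimately have norm_lim: "tends_to_0_in_prob M (\<lambda>N \<omega>. frob_norm (R N \<omega>)) sequentially"
    by (simp add: frob_norm_square flip: tends_to_0_in_prob_square_iff)
  have "prob_space (M N) \<and> g N \<ge> 0 \<and> random_mat (M N) N N (R N)
      \<and> iid_gaussian_entries (M N) N N (g N / real N) (R N)" if N: "N \<ge> 1" for N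
  proof -
    have "g N / real N \<ge> 0" using g_nonneg[OF N] by simp
    then have "iid_gaussian_entries (M N) N N (g N / real N) (R N)"
      by (rule prob_space.cond_iid_imp_iid_gaussian_entries
          [OF prob[OF N] sub[OF N] conjunct2[OF SR[OF N]] _ gaussian[OF N]])
    then show ?thesis
      by (intro conjI prob[OF N] g_nonneg[OF N] conjunct2[OF SR[OF N]])
  qed
  from tends_to_0_in_prob_frob_norm_gaussian_iff[of M g "\<lambda>N. N" R, OF this]
  have gN: "(\<lambda>N. g N * real N) \<longlonglongrightarrow> 0"
    by (rule iffD1) (simp_all add: norm_lim)
  \<comment> \<open>For aspect ratio 1 the factor \<open>(1 + sqrt 1)\<^sup>2\<close> is 4, and the
    layer size cancels against the variance \<open>g N / N\<close>.\<close>
  have edge: "mp_singular_edge N N (g N / real N) = 2 * sqrt (g N)" if "N \<ge> 1" for N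
    using that by (simp add: mp_singular_edge_def mp_lambda_plus_def real_sqrt_mult)
  \<comment> \<open>The edge depends on \<open>g N\<close> alone, recovered from the stronger decay
    of \<open>g N * N\<close> through the factor \<open>1 / N\<close>.\<close>
  have "(\<lambda>N. g N * real N * (1 / real N)) \<longlonglongrightarrow> 0 * 0"
    by (intro tendsto_mult gN lim_1_over_n)
  moreover have "\<forall>\<^sub>F N in sequentially. g N * real N * (1 / real N) = g N"
    using ge1 by eventually_elim simp
  ultimately have "g \<longlonglongrightarrow> 0" by (simp add: tendsto_cong)
  then have "(\<lambda>N. 2 * sqrt (g N)) \<longlonglongrightarrow> 2 * sqrt 0"
    by (intro tendsto_intros)
  moreover have "\<forall>\<^sub>F N in sequentially. mp_singular_edge N N (g N / real N) = 2 * sqrt (g N)"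
    using ge1 by eventually_elim (rule edge)
  ultimately have edge_lim: "(\<lambda>N. mp_singular_edge N N (g N / real N)) \<longlonglongrightarrow> 0"
    by (simp add: tendsto_cong)
  have ratio: "(\<lambda>N. \<gamma> N * real (m N)) \<longlonglongrightarrow> 0 \<longleftrightarrow> (\<lambda>N. \<gamma> N * real N) \<longlonglongrightarrow> 0"
    if c: "c > 0" "(\<lambda>N. real (m N) / real N) \<longlonglongrightarrow> c" for m :: "nat \<Rightarrow> nat" and \<gamma> :: "nat \<Rightarrow> real" and c
  proof
    assume "(\<lambda>N. \<gamma> N * real (m N)) \<longlonglongrightarrow> 0"
    then have "(\<lambda>N. \<gamma> N * real (m N) / (real (m N) / real N)) \<longlonglongrightarrow> 0 / c"
      using c by (intro tendsto_divide) auto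
    \<comment> \<open>Since \<open>c > 0\<close>, the ratio is eventually positive, so
      \<open>m N\<close> and \<open>N\<close> are nonzero and the division cancels.\<close>
    moreover have "\<forall>\<^sub>F N in sequentially. \<gamma> N * real (m N) / (real (m N) / real N) = \<gamma> N * real N"
      using order_tendstoD(1)[OF c(2,1)] by eventually_elim (auto simp: field_simps)
    ultimately show "(\<lambda>N. \<gamma> N * real N) \<longlonglongrightarrow> 0" by (simp add: tendsto_cong)
  next
    assume "(\<lambda>N. \<gamma> N * real N) \<longlonglongrightarrow> 0"
    then have "(\<lambda>N. \<gamma> N * real N * (real (m N) / real N)) \<longlonglongrightarrow> 0 * c"
      using c by (intro tendsto_mult)
    moreover have "\<forall>\<^sub>F N in sequentially. \<gamma> N * real N * (real (m N) / real N) = \<gamma> N * real (m N)"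
      using ge1 by eventually_elim simp
    ultimately show "(\<lambda>N. \<gamma> N * real (m N)) \<longlonglongrightarrow> 0" by (simp add: tendsto_cong)
  qed
  show ?thesis
    by (intro conjI gN edge_lim; intro allI impI;
        (rule edge | rule tends_to_0_in_prob_frob_norm_gaussian_iff | rule ratio); blast)
qed

end
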